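(* Let $F$ be a number field with ring of integers $\mathcal{O}_F$ and class number $h_F$. Let $p \ge 3$ be a prime number totally ramified in $F$ and set $r = \gcd(2h_F, p-1)$. Suppose the following conditions hold: (i) $\gcd\left([F:\mathbb{Q}], \frac{p-1}{2}\right) = 1$; and (ii) $\operatorname{Res}\left(X^r - 1, (X-1)^r - 1\right) \not\equiv 0 \pmod p$, where $\operatorname{Res}$ denotes the resultant of two polynomials in $\mathbb{Z}[X]$. Then the unit equation $\lambda + \mu = 1$ has no solutions with $\lambda, \mu \in \mathcal{O}_F^\times$.
   Context: A rational prime $p$ is totally ramified in a number field $F$ if $p\mathcal{O}_F = \mathfrak{p}^{[F:\mathbb{Q}]}$ for a prime ideal $\mathfrak{p}$ of $\mathcal{O}_F$. $\mathcal{O}_F^\times$ denotes the unit group of $\mathcal{O}_F$. *)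

theory Defs
  imports
    "HOL-Algebra.Ideal_Product"
    "HOL-Algebra.Coset"
    "HOL-Number_Theory.Cong"
    "Subresultants.Resultant_Prelim"
begin

text \<open>
  A number field is a type of class \<open>field_char_0\<close> that is a finite-dimensional
  vector space over \<open>rat\<close>.
\<close>

abbreviation rat_scale :: "rat \<Rightarrow> 'a::field_char_0 \<Rightarrow> 'a" where
  "rat_scale q x \<equiv> of_rat q * x"

definition number_field :: "'a::field_char_0 itself \<Rightarrow> bool" where
  "number_field _ \<longleftrightarrow> (\<exists>B :: 'a set. finite B \<and> module.span rat_scale B = UNIV)"

definition field_degree :: "'a::field_char_0 itself \<Rightarrow> nat" where
  "field_degree _ = vector_space.dim rat_scale (UNIV :: 'a set)"

definition field_as_ring :: "'a::field_char_0 ring" where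
  "field_as_ring = \<lparr>carrier = UNIV, monoid.mult = (*), one = 1, zero = 0, add = (+)\<rparr>"

definition ring_of_integers :: "'a::field_char_0 ring" where
  "ring_of_integers = field_as_ring\<lparr>carrier := {x. algebraic_int x}\<rparr>"

definition totally_ramified :: "'a::field_char_0 itself \<Rightarrow> nat \<Rightarrow> bool" where
  "totally_ramified _ p \<longleftrightarrow>
     (\<exists>P. primeideal P (ring_of_integers :: 'a ring) \<and>
          PIdl\<^bsub>ring_of_integers\<^esub> (of_nat p) = P [^]\<^bsub>ideals_set ring_of_integers\<^esub> field_degree TYPE('a))"

definition fractional_ideal :: "'a::field_char_0 set \<Rightarrow> bool" where
  "fractional_ideal I \<longleftrightarrow>
     additive_subgroup I field_as_ring \<and> I \<noteq> {0} \<and>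
     (\<forall>a\<in>carrier ring_of_integers. \<forall>x\<in>I. a * x \<in> I) \<and>
     (\<exists>d\<in>carrier ring_of_integers. d \<noteq> 0 \<and> (\<forall>x\<in>I. d * x \<in> carrier ring_of_integers))"

definition fractional_ideal_group :: "'a::field_char_0 set monoid" where
  "fractional_ideal_group =
     \<lparr>carrier = {I. fractional_ideal I}, monoid.mult = ideal_prod field_as_ring, one = carrier ring_of_integers\<rparr>"

definition principal_fractional_ideals :: "'a::field_char_0 set set" where
  "principal_fractional_ideals = {(*) x ` carrier ring_of_integers | x. x \<noteq> 0}"

definition class_group :: "'a::field_char_0 set set monoid" where
  "class_group = fractional_ideal_group Mod principal_fractional_ideals"

definition class_number :: "'a::field_char_0 itself \<Rightarrow> nat" where
  "class_number _ = Coset.order (class_group :: 'a set set monoid)"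

end

theory Submission
  imports Defs "HOL-Number_Theory.Pocklington"
begin

text \<open>
  Write \<open>p O = P^n\<close> with \<open>n = [F : Q]\<close>. Elements \<open>x k\<close> of \<open>P^k\<close> outside \<open>P^(k + 1)\<close>, for \<open>k < n\<close>,
  form a basis of \<open>F\<close> that generates \<open>O\<close> over the localisation of the integers at \<open>p\<close>. Hence
  every integer of \<open>F\<close> is congruent modulo \<open>P\<close> to a rational integer \<open>a\<close>, and its multiplication
  matrix in this basis is modulo \<open>p\<close> triangular with diagonal entries \<open>a\<close>. For a unit the determinant
  is 1 or -1, so \<open>a^(2n) = 1\<close> modulo \<open>p\<close>; with \<open>a^(p - 1) = 1\<close> and condition (i) this
  gives \<open>a = 1\<close> or \<open>a = -1\<close>. Two such residues add up to 1 only if \<open>p = 3\<close>, both being -1. But then \<open>r = 2\<close>, and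
  -1 is a common root modulo 3 of the two polynomials in condition (ii).
\<close>

section \<open>Integers, determinants and a resultant\<close>

text \<open>In lowest terms \<open>t = u / v\<close>, every power of \<open>v\<close> divides the
  fixed nonzero \<open>e\<close>, so \<open>v\<close> cannot exceed 1.\<close>

lemma Ints_if_powers_bounded_denominator:
  fixes t :: rat and e :: int
  assumes "e \<noteq> 0" and int: "\<And>k. of_int e * t ^ k \<in> \<int>"
  shows "t \<in> \<int>"
proof -
  obtain u v where uv: "quotient_of t = (u, v)" by fastforce
  have v: "v > 0" and cop: "coprime u v" and t: "t = of_int u / of_int v"
    using quotient_of_denom_pos[OF uv] quotient_of_coprime[OF uv] quotient_of_div[OF uv] by auto
  have dvd: "v ^ k dvd e" for k
  proof -
    obtain w where w: "of_int e * t ^ k = of_int w" using int[of k] by (auto elim: Ints_cases)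
    have "rat_of_int (e * u ^ k) = of_int (w * v ^ k)"
      using w v by (simp add: t power_divide field_simps)
    hence "e * u ^ k = w * v ^ k" using of_int_eq_iff by blast
    hence "v ^ k dvd e * u ^ k" by simp
    thus ?thesis using cop by (simp add: coprime_commute coprime_dvd_mult_left_iff)
  qed
  have "v = 1"
  proof (rule ccontr)
    assume "v \<noteq> 1"
    hence "2 \<le> v" using v by simp
    hence "2 ^ nat \<bar>e\<bar> \<le> v ^ nat \<bar>e\<bar>" by (intro power_mono) auto
    also have "\<dots> \<le> \<bar>e\<bar>" using dvd[of "nat \<bar>e\<bar>"] assms(1) by (intro zdvd_imp_le) auto
    finally have "int (2 ^ nat \<bar>e\<bar>) \<le> int (nat \<bar>e\<bar>)" by simp
    thus False by (metis less_exp not_less of_nat_le_iff)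
  qed
  thus ?thesis by (simp add: t)
qed

lemma common_denominator:
  fixes q :: "'b \<Rightarrow> rat"
  assumes "finite I"
  shows "\<exists>d z. d \<noteq> (0::int) \<and> (\<forall>i\<in>I. of_int d * q i = of_int (z i))"
  using assms
proof (induction I)
  case empty
  show ?case by (intro exI[of _ 1]) auto
next
  case (insert i I)
  then obtain d z where dz: "d \<noteq> 0" "\<forall>i\<in>I. of_int d * q i = of_int (z i)" by blast
  obtain u v where uv: "quotient_of (q i) = (u, v)" by fastforce
  have "v > 0" "q i = of_int u / of_int v"
    using quotient_of_denom_pos[OF uv] quotient_of_div[OF uv] by auto
  thus ?case using dz insert.hyps
    by (intro exI[of _ "d * v"] exI[of _ "\<lambda>j. if j = i then d * u else z j * v"])
      (auto simp: algebra_simps)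
qed

text \<open>In the Leibniz formula each entry may be replaced modulo \<open>m\<close>, which turns
  \<open>Z\<close> into a genuinely triangular matrix \<open>U\<close> with constant diagonal
  \<open>c\<close>.\<close>

lemma det_cong_upper_triangular:
  fixes Z :: "int mat"
  assumes Z: "Z \<in> carrier_mat n n"
    and low: "\<And>i j. i < n \<Longrightarrow> j < i \<Longrightarrow> m dvd Z $$ (i, j)"
    and diag: "\<And>i. i < n \<Longrightarrow> [Z $$ (i, i) = c] (mod m)"
  shows "[det Z = c ^ n] (mod m)"
proof -
  define U where "U = mat n n (\<lambda>(i, j). if j < i then 0 else if i = j then c else Z $$ (i, j))"
  have U: "U \<in> carrier_mat n n" by (simp add: U_def)
  have "[(\<Sum>f | f permutes {0..<n}. signof f * (\<Prod>i = 0..<n. Z $$ (i, f i)))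
      = (\<Sum>f | f permutes {0..<n}. signof f * (\<Prod>i = 0..<n. U $$ (i, f i)))] (mod m)"
  proof (intro cong_sum cong_mult cong_refl cong_prod)
    fix f i assume f: "f \<in> {f. f permutes {0..<n}}" and i: "i \<in> {0..<n}"
    have "f i < n" using f i permutes_in_image by fastforce
    thus "[Z $$ (i, f i) = U $$ (i, f i)] (mod m)"
      using i low[of i "f i"] diag[of i] by (auto simp: U_def cong_0_iff)
  qed
  hence "[det Z = det U] (mod m)" by (simp add: det_def'[OF Z] det_def'[OF U])
  moreover have "det U = prod_list (diag_mat U)"
    by (rule det_upper_triangular[OF _ U]) (auto simp: U_def upper_triangular_def)
  moreover have "diag_mat U = replicate n c"
    by (intro nth_equalityI) (auto simp: diag_mat_def U_def)
  ultimately show ?thesis by simp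
qed

text \<open>
  Modulo 3 both polynomials vanish at -1, so their Sylvester matrix sends the vector of powers
  of -1 to zero; its last entry is 1, and multiplying by the adjugate gives the claim.
\<close>
lemma three_dvd_resultant:
  "[resultant ([:0, 1:] ^ 2 - 1) (([:0, 1:] - 1) ^ 2 - 1) = (0::int)] (mod 3)"
proof -
  have pq: "[:0, 1:] ^ 2 - 1 = [:-1, 0, 1::int:]" "([:0, 1:] - 1) ^ 2 - 1 = [:0, -2, 1::int:]"
    by (simp_all add: power2_eq_square one_pCons)
  define S where "S = sylvester_mat [:-1, 0, 1::int:] [:0, -2, 1:]"
  have S: "S \<in> carrier_mat 4 4"
    using sylvester_carrier_mat[of "[:-1, 0, 1::int:]" "[:0, -2, 1:]"] 
    by (simp add: S_def numeral_eq_Suc)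
  define v :: "int vec" where "v = vec 4 (\<lambda>i. (-1) ^ (3 - i))"
  have i: "i = 0 \<or> i = 1 \<or> i = 2 \<or> i = 3" if "i < 4" for i :: nat using that by auto
  have Sv: "S *\<^sub>v v = 3 \<cdot>\<^sub>v vec 4 (\<lambda>i. if i < 2 then 0 else if i = 2 then -1 else 1)"
    apply (rule eq_vecI)
    using S apply (auto simp: v_def dest!: i)
    apply (auto simp: S_def v_def scalar_prod_def row_def sylvester_index_mat numeral_eq_Suc)
    done
  let ?w = "vec 4 (\<lambda>i. if i < 2 then 0 else if i = 2 then -1 else 1) :: int vec"
  have v: "v \<in> carrier_vec 4" by (simp add: v_def)
  have adj: "adj_mat S \<in> carrier_mat 4 4" by (rule adj_mat(1)[OF S])
  have "det S = ((adj_mat S * S) *\<^sub>v v) $ 3"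
    unfolding adj_mat(3)[OF S] by (simp add: v_def row_def scalar_prod_def numeral_eq_Suc)
  also have "\<dots> = (adj_mat S *\<^sub>v (S *\<^sub>v v)) $ 3"
    by (simp add: assoc_mult_mat_vec[OF adj S v])
  also have "\<dots> = 3 * (row (adj_mat S) 3 \<bullet> ?w)"
    unfolding Sv using adj by (simp add: scalar_prod_smult_distrib[where n = 4])
  finally have "det S = 3 * (row (adj_mat S) 3 \<bullet> ?w)" .
  thus ?thesis by (simp add: pq resultant_def S_def cong_0_iff)
qed

text \<open>The multiplicative order of \<open>a\<close> modulo \<open>p\<close> divides
  \<open>2 * n\<close> and, by Fermat, \<open>p - 1\<close>; the coprimality condition reduces their
  gcd to 2.\<close>

lemma cong_square_eq_1:
  fixes a :: int
  assumes p: "prime p" "p \<ge> 3" and n: "n > 0" and gcd: "gcd n ((p - 1) div 2) = 1"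
    and a: "[a ^ (2 * n) = 1] (mod int p)"
  shows "[a ^ 2 = 1] (mod int p)"
proof -
  \<comment> \<open>Orders and Fermat's theorem are used over the naturals, so \<open>a\<close> is
    replaced by its least nonnegative residue.\<close>
  define b where "b = nat (a mod int p)"
  have "int b = a mod int p" using p by (simp add: b_def)
  hence ab: "[int b ^ k = a ^ k] (mod int p)" for k
    by (intro cong_pow) (simp add: cong_def)
  have "[int (b ^ (2 * n)) = int 1] (mod int p)"
    using cong_trans[OF ab a] by simp
  hence b: "[b ^ (2 * n) = 1] (mod p)" by (simp only: cong_int_iff)
  have "\<not> p dvd b"
  proof
    assume "p dvd b"
    hence "p dvd b ^ (2 * n)" using n by (intro dvd_power_le[of p b 1 "2 * n", simplified]) auto
    hence "p dvd 1" using b by (simp only: cong_dvd_iff)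
    thus False using p by simp
  qed
  hence "[b ^ (p - 1) = 1] (mod p)" using p by (intro fermat_theorem) auto
  hence "ord p b dvd gcd (2 * n) (p - 1)" using b by (simp add: ord_divides')
  moreover have "odd p" using p prime_odd_nat by auto
  hence "p - 1 = 2 * ((p - 1) div 2)" by simp
  hence "gcd (2 * n) (p - 1) = 2"
    using gcd by (metis gcd_mult_distrib_nat mult_1_right)
  ultimately have "[b ^ 2 = 1] (mod p)" by (simp only: ord_divides)
  hence "[int (b ^ 2) = int 1] (mod int p)" by (simp only: cong_int_iff)
  thus ?thesis using cong_trans[OF cong_sym[OF ab[of 2]]] by simp
qed

section \<open>Bases adapted to the powers of an ideal\<close>

text \<open>Here \<open>Q k\<close> abstracts the power \<open>P^k\<close>, with \<open>Q 0\<close>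
  in the role of the ring of integers. The equation for \<open>Q n\<close> encodes total
  ramification.\<close>

locale ideal_filtration =
  fixes Q :: "nat \<Rightarrow> 'a::field_char_0 set" and n p :: nat
  assumes one: "1 \<in> Q 0"
    and diff: "x \<in> Q k \<Longrightarrow> y \<in> Q k \<Longrightarrow> x - y \<in> Q k"
    and mult: "x \<in> Q 0 \<Longrightarrow> y \<in> Q k \<Longrightarrow> x * y \<in> Q k"
    and mult1: "x \<in> Q 1 \<Longrightarrow> y \<in> Q k \<Longrightarrow> x * y \<in> Q (Suc k)"
    and strict: "k < n \<Longrightarrow> Q (Suc k) \<subset> Q k"
    and Q_n: "Q n = (*) (of_nat p) ` Q 0"
    and p: "prime p"
    and n: "n > 0"
begin

lemma zero: "x \<in> Q k \<Longrightarrow> 0 \<in> Q k"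
  using diff[of x k x] by simp

lemma add: "x \<in> Q k \<Longrightarrow> y \<in> Q k \<Longrightarrow> x + y \<in> Q k"
  using diff[of x k "0 - y"] diff[of 0 k y] zero by simp

lemma of_int: "of_int a \<in> Q 0"
proof (induction a rule: int_induct[where k = 0])
  case base
  show ?case using zero[OF one] by simp
next
  case (step1 i)
  thus ?case using add[OF _ one] by simp
next
  case (step2 i)
  thus ?case using diff[OF _ one] by simp
qed

lemma smult: "x \<in> Q k \<Longrightarrow> of_int a * x \<in> Q k"
  using mult of_int by blast

lemma antimono: "j \<le> k \<Longrightarrow> k \<le> n \<Longrightarrow> Q k \<subseteq> Q j"
proof (induction k rule: dec_induct)
  case (step m)
  thus ?case using strict[of m] by auto
qed simp

lemma dvd_smult_in_Q:
  assumes "x \<in> Q 0" "int p dvd a" "k \<le> n"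
  shows "of_int a * x \<in> Q k"
proof -
  obtain b where b: "a = int p * b" using assms(2) by blast
  have "of_int a * x = of_nat p * (of_int b * x)" by (simp add: b)
  moreover have "of_int b * x \<in> Q 0" using smult assms(1) .
  ultimately have "of_int a * x \<in> Q n" unfolding Q_n by blast
  thus ?thesis using antimono[OF assms(3)] by auto
qed

lemma sum: "(\<And>i. i \<in> I \<Longrightarrow> f i \<in> Q k) \<Longrightarrow> k \<le> n \<Longrightarrow> sum f I \<in> Q k"
proof (induction I rule: infinite_finite_induct)
  case (insert i I)
  thus ?case using add by simp
qed (use dvd_smult_in_Q[OF one, of 0 k] in simp_all)

text \<open>Bezout gives \<open>1 = u p + v a\<close>; the multiple of \<open>p\<close> already lies
  in \<open>Q n\<close>, hence in \<open>Q k\<close>, so \<open>a\<close> acts invertibly modulo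
  \<open>Q k\<close>.\<close>

lemma cancel_coprime_smult:
  assumes "x \<in> Q 0" "of_int a * x \<in> Q k" "\<not> int p dvd a" "k \<le> n"
  shows "x \<in> Q k"
proof -
  have "coprime (int p) a" using p assms(3) by (simp add: prime_imp_coprime)
  then obtain u v where uv: "u * int p + v * a = 1"
    by (metis bezout_int coprime_iff_gcd_eq_1 coprime_imp_gcd_eq_1)
  have "x = of_int (u * int p + v * a) * x" by (simp add: uv)
  also have "\<dots> = of_int (u * int p) * x + of_int v * (of_int a * x)" by (simp add: algebra_simps)
  also have "\<dots> \<in> Q k"
    using dvd_smult_in_Q[OF assms(1) _ assms(4), of "u * int p"] smult[OF assms(2)] by (intro add) auto
  finally show ?thesis .
qed

text \<open>An integer of \<open>Q 1\<close> prime to \<open>p\<close> could be cancelled, leaving 1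
  in \<open>Q 1\<close> and contradicting the strict inclusion in \<open>Q 0\<close>.\<close>

lemma of_int_in_Q1_iff: "of_int a \<in> Q 1 \<longleftrightarrow> int p dvd a"
proof
  assume "int p dvd a"
  thus "of_int a \<in> Q 1" using dvd_smult_in_Q[OF one, of a 1] n by simp
next
  assume a: "of_int a \<in> Q 1"
  show "int p dvd a"
  proof (rule ccontr)
    assume "\<not> int p dvd a"
    hence "1 \<in> Q 1" using cancel_coprime_smult[OF one, of a 1] a n by simp
    hence "x \<in> Q 1" if "x \<in> Q 0" for x using mult[OF that, of 1 1] by simp
    thus False using strict[OF n] by auto
  qed
qed

end

text \<open>The element \<open>x k\<close> has exact level \<open>k\<close>, like the power of a
  uniformizer. Fixing \<open>x 0 = 1\<close> makes residues modulo \<open>Q 1\<close> readable from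
  the coordinate 0.\<close>

locale adapted_basis = ideal_filtration Q n p
  for Q :: "nat \<Rightarrow> 'a::field_char_0 set" and n p +
  fixes x :: "nat \<Rightarrow> 'a"
  assumes x: "k < n \<Longrightarrow> x k \<in> Q k - Q (Suc k)" and x0: "x 0 = 1"
begin

lemma x_in_Q0: "k < n \<Longrightarrow> x k \<in> Q 0"
  using x[of k] antimono[of 0 k] by auto

text \<open>Induction on \<open>j\<close>: terms before \<open>j\<close> have coefficients divisible
  by \<open>p\<close> and so lie in \<open>Q n\<close>, terms after \<open>j\<close> lie in
  \<open>Q (Suc j)\<close> by their level. Hence \<open>c j * x j\<close> lies in
  \<open>Q (Suc j)\<close> too, which the exact level of \<open>x j\<close> permits only if
  \<open>p\<close> divides \<open>c j\<close>.\<close>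

lemma dvd_coeff:
  assumes "(\<Sum>j<n. of_int (c j) * x j) \<in> Q k" "k \<le> n" "j < k"
  shows "int p dvd c j"
  using assms(3)
proof (induction j rule: less_induct)
  case (less j)
  have j: "j < n" using less.prems assms(2) by simp
  have "of_int (c i) * x i \<in> Q (Suc j)" if "i < n" "i \<noteq> j" for i
  proof (cases "i < j")
    case True
    thus ?thesis using less dvd_smult_in_Q[OF x_in_Q0] that j by auto
  next
    case False
    hence "x i \<in> Q (Suc j)" using that x[of i] antimono[of "Suc j" i] by auto
    thus ?thesis by (rule smult)
  qed
  hence "(\<Sum>i\<in>{..<n} - {j}. of_int (c i) * x i) \<in> Q (Suc j)" using j by (intro sum) auto
  moreover have "(\<Sum>j<n. of_int (c j) * x j) \<in> Q (Suc j)"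
    using assms(1,2) antimono[of "Suc j" k] less.prems by auto
  ultimately have "of_int (c j) * x j \<in> Q (Suc j)"
    using diff[of "\<Sum>j<n. of_int (c j) * x j" "Suc j" "\<Sum>i\<in>{..<n} - {j}. of_int (c i) * x i"] j
    by (simp add: sum.remove[of "{..<n}" j])
  thus ?case using cancel_coprime_smult[OF x_in_Q0[OF j], of "c j" "Suc j"] x[OF j] j by auto
qed

text \<open>Since 0 lies in \<open>Q n\<close>, all coefficients are divisible by \<open>p\<close>;
  dividing by \<open>p\<close> yields another zero combination, and the argument repeats.\<close>

lemma zero_combination_dvd_power:
  assumes "(\<Sum>j<n. of_int (c j) * x j) = 0" "j < n"
  shows "int p ^ m dvd c j"
  using assms
proof (induction m arbitrary: c j)
  case (Suc m)
  have "0 \<in> Q n" using dvd_smult_in_Q[OF one, of 0 n] by simp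
  hence dvd: "int p dvd c i" if "i < n" for i
    using dvd_coeff[of c n i] Suc.prems(1) that by simp
  define d where "d i = c i div int p" for i
  have c: "c i = int p * d i" if "i < n" for i using dvd[OF that] by (simp add: d_def)
  have "(\<Sum>j<n. of_int (c j) * x j) = of_nat p * (\<Sum>j<n. of_int (d j) * x j)"
    unfolding sum_distrib_left by (rule sum.cong) (auto simp: c)
  hence "(\<Sum>j<n. of_int (d j) * x j) = 0" using Suc.prems(1) p by (auto simp: prime_gt_0_nat)
  thus ?case using Suc.IH[of d j] c Suc.prems(2) by simp
qed simp

lemma zero_combination:
  assumes "(\<Sum>j<n. of_int (c j) * x j) = 0" "j < n"
  shows "c j = 0"
proof (rule ccontr)
  assume nz: "c j \<noteq> 0"
  \<comment> \<open>This exponent is large enough, because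
    \<open>p ^ m >= 2 ^ m > m\<close>.\<close>
  let ?m = "nat \<bar>c j\<bar>"
  have "int (2 ^ ?m) \<le> int p ^ ?m" using prime_ge_2_nat[OF p] by (simp add: power_mono)
  also have "\<dots> \<le> int ?m"
    using zero_combination_dvd_power[OF assms, of ?m] nz by (simp add: zdvd_imp_le)
  finally show False by (metis less_exp not_less of_nat_le_iff)
qed

lemma rat_zero_combination:
  assumes "(\<Sum>j<n. of_rat (q j) * x j) = 0" "j < n"
  shows "q j = 0"
proof -
  obtain d z where dz: "d \<noteq> (0::int)" "\<forall>i\<in>{..<n}. of_int d * q i = of_int (z i)"
    using common_denominator[of "{..<n}" q] by auto
  have "of_int (z i) = of_int d * (of_rat (q i) :: 'a)" if "i < n" for i
    using dz(2) that by (metis lessThan_iff of_rat_mult of_rat_of_int_eq)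
  hence "(\<Sum>j<n. of_int (z j) * x j) = of_int d * (\<Sum>j<n. of_rat (q j) * x j)"
    unfolding sum_distrib_left by (intro sum.cong) auto
  hence "z j = 0" using zero_combination[of z j] assms by simp
  thus ?thesis using dz assms(2) by force
qed

end

lemma (in ideal_filtration) adapted_basis_exists: "\<exists>x. adapted_basis Q n p x"
proof -
  define x where "x k = (if k = 0 then 1 else SOME y. y \<in> Q k - Q (Suc k))" for k
  have "x k \<in> Q k - Q (Suc k)" if "k < n" for k
  proof (cases "k = 0")
    case True
    have "1 \<notin> Q 1" using of_int_in_Q1_iff[of 1] prime_ge_2_nat[OF p] by simp
    thus ?thesis using True one by (simp add: x_def)
  next
    case False
    have "\<exists>y. y \<in> Q k - Q (Suc k)" using strict[OF that] by blast
    hence "(SOME y. y \<in> Q k - Q (Suc k)) \<in> Q k - Q (Suc k)" by (rule someI_ex)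
    thus ?thesis using False by (simp add: x_def)
  qed
  hence "adapted_basis Q n p x" by unfold_locales (auto simp: x_def)
  thus ?thesis by blast
qed

section \<open>The adapted basis over the rationals and its integral lattice\<close>

locale adapted_rat_basis = adapted_basis Q n p x
  for Q :: "nat \<Rightarrow> 'a::field_char_0 set" and n p x +
  assumes number_field: "number_field TYPE('a)" and degree: "n = field_degree TYPE('a)"
begin

sublocale rat_vs: vector_space "rat_scale :: rat \<Rightarrow> 'a \<Rightarrow> 'a"
  by unfold_locales (simp_all add: algebra_simps of_rat_add of_rat_mult)

lemma inj_on_x: "inj_on x {..<n}"
proof (rule inj_onI)
  fix i j assume ij: "i \<in> {..<n}" "j \<in> {..<n}" "x i = x j"
  show "i = j"
  proof (rule ccontr)
    assume "i \<noteq> j"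
    let ?c = "\<lambda>k. if k = i then 1 else if k = j then -1 else (0::int)"
    have "(\<Sum>k<n. of_int (?c k) * x k) = (\<Sum>k\<in>{i, j}. of_int (?c k) * x k)"
      using ij by (intro sum.mono_neutral_right) auto
    also have "\<dots> = 0" using \<open>i \<noteq> j\<close> ij by simp
    finally have "?c i = 0" using zero_combination[of ?c i] ij by simp
    thus False by simp
  qed
qed

lemma independent_x: "rat_vs.independent (x ` {..<n})"
proof
  assume "rat_vs.dependent (x ` {..<n})"
  then obtain u v where uv: "v \<in> x ` {..<n}" "u v \<noteq> 0" "(\<Sum>v\<in>x ` {..<n}. of_rat (u v) * v) = 0"
    by (auto simp: rat_vs.dependent_finite)
  have "(\<Sum>j<n. of_rat (u (x j)) * x j) = 0"
    using uv(3) by (simp add: sum.reindex[OF inj_on_x])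
  thus False using rat_zero_combination[of "\<lambda>j. u (x j)"] uv(1,2) by auto
qed

text \<open>An element outside the span would extend the family to \<open>n + 1\<close> independent
  elements in a space of dimension \<open>n\<close>.\<close>

lemma span_x: "rat_vs.span (x ` {..<n}) = UNIV"
proof (rule ccontr)
  assume "rat_vs.span (x ` {..<n}) \<noteq> UNIV"
  then obtain y where y: "y \<notin> rat_vs.span (x ` {..<n})" by blast
  have ind: "rat_vs.independent (insert y (x ` {..<n}))"
    using y independent_x by (rule rat_vs.independent_insertI)
  \<comment> \<open>The finite spanning set \<open>F\<close> forces the basis \<open>B\<close> to be
    finite, so that \<open>card B\<close> bounds independent sets.\<close>
  obtain F where F: "finite F" "rat_vs.span F = (UNIV :: 'a set)"
    using number_field unfolding number_field_def by blast
  obtain B where "B \<subseteq> UNIV" and B: "rat_vs.independent B" "UNIV \<subseteq> rat_vs.span B"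
    and card: "card B = rat_vs.dim (UNIV :: 'a set)"
    by (rule rat_vs.basis_exists)
  have "finite B" using rat_vs.independent_span_bound[OF F(1) B(1)] F(2) by simp
  hence "card (insert y (x ` {..<n})) \<le> card B"
    using rat_vs.independent_span_bound[OF _ ind, of B] B(2) by auto
  moreover have "y \<notin> x ` {..<n}" using y rat_vs.span_base by (rule contrapos_nn)
  hence "card (insert y (x ` {..<n})) = Suc n" by (simp add: card_image[OF inj_on_x])
  moreover have "rat_vs.dim (UNIV :: 'a set) = n"
    by (simp add: degree field_degree_def)
  ultimately show False using card by simp
qed

text \<open>The free abelian group on the adapted basis; \<open>multiple_in_lattice_coprime\<close>
  shows that it agrees with \<open>Q 0\<close> after localisation at \<open>p\<close>.\<close>

definition lattice :: "'a set" where
  "lattice = range (\<lambda>z :: nat \<Rightarrow> int. \<Sum>j<n. of_int (z j) * x j)"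

lemma latticeI: "u = (\<Sum>j<n. of_int (z j) * x j) \<Longrightarrow> u \<in> lattice"
  by (auto simp: lattice_def)

lemma lattice_add: "u \<in> lattice \<Longrightarrow> v \<in> lattice \<Longrightarrow> u + v \<in> lattice"
proof -
  assume "u \<in> lattice" "v \<in> lattice"
  then obtain a b :: "nat \<Rightarrow> int" where "u = (\<Sum>j<n. of_int (a j) * x j)" "v = (\<Sum>j<n. of_int (b j) * x j)"
    by (auto simp: lattice_def)
  hence "u + v = (\<Sum>j<n. of_int (a j + b j) * x j)" by (simp add: sum.distrib algebra_simps)
  thus ?thesis by (rule latticeI)
qed

lemma lattice_smult: "u \<in> lattice \<Longrightarrow> of_int c * u \<in> lattice"
proof -
  assume "u \<in> lattice"
  then obtain a :: "nat \<Rightarrow> int" where "u = (\<Sum>j<n. of_int (a j) * x j)"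
    by (auto simp: lattice_def)
  hence "of_int c * u = (\<Sum>j<n. of_int (c * a j) * x j)" by (simp add: sum_distrib_left mult.assoc)
  thus ?thesis by (rule latticeI)
qed

lemma lattice_0: "0 \<in> lattice"
  unfolding lattice_def by (rule image_eqI[of _ _ "\<lambda>_. 0"]) auto

lemma lattice_sum: "(\<And>i. i \<in> I \<Longrightarrow> f i \<in> lattice) \<Longrightarrow> sum f I \<in> lattice"
  by (induction I rule: infinite_finite_induct) (auto intro: lattice_add lattice_0)

lemma multiple_in_lattice: "\<exists>d. d \<noteq> 0 \<and> of_int d * y \<in> lattice"
proof -
  have "y \<in> rat_vs.span (x ` {..<n})" using span_x by simp
  then obtain u where "y = (\<Sum>v\<in>x ` {..<n}. of_rat (u v) * v)"
    by (auto simp: rat_vs.span_finite)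
  hence y: "y = (\<Sum>j<n. of_rat (u (x j)) * x j)" by (simp add: sum.reindex[OF inj_on_x])
  obtain d z where dz: "d \<noteq> (0::int)" "\<forall>i\<in>{..<n}. of_int d * u (x i) = of_int (z i)"
    using common_denominator[of "{..<n}" "\<lambda>i. u (x i)"] by auto
  have "of_int (z i) = of_int d * (of_rat (u (x i)) :: 'a)" if "i < n" for i
    using dz(2) that by (metis lessThan_iff of_rat_mult of_rat_of_int_eq)
  hence "of_int d * y = (\<Sum>j<n. of_int (z j) * x j)"
    unfolding y sum_distrib_left by (intro sum.cong) auto
  thus ?thesis using dz(1) latticeI by blast
qed

text \<open>Factors \<open>p\<close> can be removed from a denominator \<open>d\<close>: if
  \<open>p\<close> divides \<open>d\<close>, then \<open>d * y\<close> lies in \<open>Q n\<close>,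
  all its coordinates are divisible by \<open>p\<close>, and \<open>d / p\<close> is a denominator
  as well.\<close>

lemma multiple_in_lattice_coprime:
  assumes y: "y \<in> Q 0"
  shows "\<exists>d. \<not> int p dvd d \<and> of_int d * y \<in> lattice"
proof -
  have "\<exists>d. \<not> int p dvd d \<and> of_int d * y \<in> lattice"
    if "d \<noteq> 0" "of_int d * y \<in> lattice" for d
    using that
  proof (induction "nat \<bar>d\<bar>" arbitrary: d rule: less_induct)
    case less
    show ?case
    proof (cases "int p dvd d")
      case True
      then obtain e where e: "d = int p * e" by blast
      obtain z :: "nat \<Rightarrow> int" where z: "of_int d * y = (\<Sum>j<n. of_int (z j) * x j)"
        using less.prems(2) by (auto simp: lattice_def)
      have "of_int d * y \<in> Q n" by (rule dvd_smult_in_Q[OF y True]) simp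
      hence "int p dvd z j" if "j < n" for j using dvd_coeff[of z n j] z that by simp
      then obtain w where w: "z j = int p * w j" if "j < n" for j unfolding dvd_def by metis
      have "of_nat p * (of_int e * y) = of_int d * y" by (simp add: e mult.assoc)
      also have "\<dots> = of_nat p * (\<Sum>j<n. of_int (w j) * x j)"
        unfolding z sum_distrib_left by (rule sum.cong) (simp_all add: w mult.assoc)
      finally have "of_int e * y = (\<Sum>j<n. of_int (w j) * x j)"
        using prime_gt_0_nat[OF p] by (metis mult_left_cancel of_nat_eq_0_iff less_irrefl)
      hence "of_int e * y \<in> lattice" by (rule latticeI)
      moreover have "nat \<bar>e\<bar> < nat \<bar>d\<bar>" using less.prems(1) prime_ge_2_nat[OF p]
        by (simp add: e abs_mult)
      moreover have "e \<noteq> 0" using less.prems(1) e by simp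
      ultimately show ?thesis using less.hyps by blast
    qed (use less.prems in blast)
  qed
  thus ?thesis using multiple_in_lattice by blast
qed

text \<open>The predicate \<open>G\<close> allows two uses: denominators that are nonzero, and
  denominators prime to \<open>p\<close>.\<close>

lemma common_multiple_in_lattice:
  assumes "finite Y" "\<And>y. y \<in> Y \<Longrightarrow> \<exists>d. G d \<and> of_int d * y \<in> lattice"
    and "G 1" "\<And>a b. G a \<Longrightarrow> G b \<Longrightarrow> G (a * b)"
  shows "\<exists>d. G d \<and> (\<forall>y\<in>Y. of_int d * y \<in> lattice)"
  using assms(1,2)
proof (induction Y)
  case (insert y Y)
  obtain d where d: "G d" "\<forall>y\<in>Y. of_int d * y \<in> lattice" using insert by blast
  obtain e where e: "G e" "of_int e * y \<in> lattice" using insert.prems by blast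
  have "of_int (d * e) * u \<in> lattice" if "u \<in> insert y Y" for u
  proof (cases "u = y")
    case True
    thus ?thesis using lattice_smult[OF e(2), of d] by (simp add: mult.assoc)
  next
    case False
    hence "of_int d * u \<in> lattice" using that d(2) by blast
    thus ?thesis using lattice_smult[of "of_int d * u" e] by (simp add: ac_simps)
  qed
  thus ?case using assms(4) d(1) e(1) by blast
qed (use assms(3) in auto)

section \<open>Multiplication matrices and norms\<close>

text \<open>
  \<open>Z\<close> is \<open>d\<close> times the matrix of multiplication by \<open>y\<close>; clearing the denominator \<open>d\<close> keeps all
  matrices integral, so that they can be reduced modulo \<open>p\<close>.
\<close>
definition mult_matrix :: "int \<Rightarrow> 'a \<Rightarrow> int mat \<Rightarrow> bool" where
  "mult_matrix d y Z \<longleftrightarrow> Z \<in> carrier_mat n n \<and>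
     (\<forall>i<n. of_int d * (y * x i) = (\<Sum>j<n. of_int (Z $$ (i, j)) * x j))"

lemma mult_matrix_exists:
  assumes "\<And>i. i < n \<Longrightarrow> of_int d * (y * x i) \<in> lattice"
  shows "\<exists>Z. mult_matrix d y Z"
proof -
  have "\<exists>z :: nat \<Rightarrow> int. of_int d * (y * x i) = (\<Sum>j<n. of_int (z j) * x j)" if "i < n" for i
    using assms[OF that] by (auto simp: lattice_def)
  then obtain z :: "nat \<Rightarrow> nat \<Rightarrow> int"
    where z: "of_int d * (y * x i) = (\<Sum>j<n. of_int (z i j) * x j)" if "i < n" for i
    by metis
  show ?thesis
    by (rule exI[of _ "mat n n (\<lambda>(i, j). z i j)"]) (auto simp: mult_matrix_def z)
qed

lemma mult_matrix_one: "mult_matrix 1 1 (1\<^sub>m n)"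
proof -
  have "x i = (\<Sum>j<n. of_int (1\<^sub>m n $$ (i, j)) * x j)" if "i < n" for i
  proof -
    have "(\<Sum>j<n. of_int (1\<^sub>m n $$ (i, j)) * x j) = (\<Sum>j<n. if i = j then x j else 0)"
      using that by (intro sum.cong) auto
    thus ?thesis using that by simp
  qed
  thus ?thesis by (simp add: mult_matrix_def)
qed

lemma mult_matrix_mult:
  assumes "mult_matrix d y Z" "mult_matrix e w W"
  shows "mult_matrix (d * e) (y * w) (Z * W)"
proof -
  have Z: "Z \<in> carrier_mat n n" and W: "W \<in> carrier_mat n n"
    using assms by (auto simp: mult_matrix_def)
  have "of_int (d * e) * (y * w * x i) = (\<Sum>k<n. of_int ((Z * W) $$ (i, k)) * x k)" if i: "i < n" for i
  proof -
    have "of_int (d * e) * (y * w * x i) = of_int e * w * (of_int d * (y * x i))"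
      by (simp add: algebra_simps)
    also have "\<dots> = (\<Sum>j<n. of_int (Z $$ (i, j)) * (of_int e * (w * x j)))"
      using assms(1) i by (simp add: mult_matrix_def sum_distrib_left algebra_simps)
    also have "\<dots> = (\<Sum>j<n. of_int (Z $$ (i, j)) * (\<Sum>k<n. of_int (W $$ (j, k)) * x k))"
      using assms(2) by (simp add: mult_matrix_def)
    also have "\<dots> = (\<Sum>k<n. (\<Sum>j<n. of_int (Z $$ (i, j) * W $$ (j, k))) * x k)"
      unfolding sum_distrib_left sum_distrib_right by (subst sum.swap) (simp add: mult.assoc)
    also have "\<dots> = (\<Sum>k<n. of_int ((Z * W) $$ (i, k)) * x k)"
      using i Z W by (intro sum.cong) (auto simp: scalar_prod_def lessThan_atLeast0)
    finally show ?thesis .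
  qed
  thus ?thesis using Z W by (simp add: mult_matrix_def)
qed

lemma mult_matrix_power: "mult_matrix d y Z \<Longrightarrow> mult_matrix (d ^ k) (y ^ k) (Z ^\<^sub>m k)"
proof (induction k)
  case 0
  thus ?case using mult_matrix_one by (auto simp: mult_matrix_def)
next
  case (Suc k)
  thus ?case using mult_matrix_mult[of "d ^ k" "y ^ k" "Z ^\<^sub>m k" d y Z] by (simp add: mult.commute)
qed

text \<open>For nonzero denominators this says that the norm \<open>det Z / d^n\<close> depends on
  \<open>y\<close> alone. Independence of the basis gives equality of the matrices
  \<open>e Z\<close> and \<open>d W\<close>.\<close>

lemma det_mult_matrix_unique:
  assumes "mult_matrix d y Z" "mult_matrix e y W"
  shows "e ^ n * det Z = d ^ n * det W"
proof -
  have Z: "Z \<in> carrier_mat n n" and W: "W \<in> carrier_mat n n"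
    using assms by (auto simp: mult_matrix_def)
  have "e \<cdot>\<^sub>m Z = d \<cdot>\<^sub>m W"
  proof (rule eq_matI)
    fix i j assume "i < dim_row (d \<cdot>\<^sub>m W)" "j < dim_col (d \<cdot>\<^sub>m W)"
    hence ij: "i < n" "j < n" using W by auto
    have "(\<Sum>j<n. of_int (e * Z $$ (i, j) - d * W $$ (i, j)) * x j)
        = of_int e * (\<Sum>j<n. of_int (Z $$ (i, j)) * x j) - of_int d * (\<Sum>j<n. of_int (W $$ (i, j)) * x j)"
      by (simp add: sum_distrib_left sum_subtractf algebra_simps)
    also have "\<dots> = of_int e * (of_int d * (y * x i)) - of_int d * (of_int e * (y * x i))"
      using assms ij by (simp add: mult_matrix_def)
    also have "\<dots> = 0" by simp
    finally show "(e \<cdot>\<^sub>m Z) $$ (i, j) = (d \<cdot>\<^sub>m W) $$ (i, j)"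
      using zero_combination[of "\<lambda>j. e * Z $$ (i, j) - d * W $$ (i, j)" j] ij Z W by simp
  qed (use Z W in auto)
  hence "det (e \<cdot>\<^sub>m Z) = det (d \<cdot>\<^sub>m W)" by simp
  thus ?thesis using Z W by simp
qed

text \<open>A common denominator for the powers of \<open>y\<close> below the degree of a monic
  integral equation serves all powers, since that equation rewrites higher powers with integer
  coefficients.\<close>

lemma algebraic_int_powers_lattice:
  assumes "algebraic_int y"
  shows "\<exists>d. d \<noteq> 0 \<and> (\<forall>k. \<forall>i<n. of_int d * (y ^ k * x i) \<in> lattice)"
proof -
  obtain f :: "int poly" where f: "poly (map_poly of_int f) y = 0" "lead_coeff f = 1"
    using assms by (auto simp: algebraic_int_altdef_ipoly)
  let ?m = "degree f"
  have "(\<Sum>l\<le>?m. of_int (poly.coeff f l) * y ^ l) = 0"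
    using f(1) by (simp add: poly_altdef degree_map_poly coeff_map_poly)
  hence ym: "y ^ ?m = - (\<Sum>l<?m. of_int (poly.coeff f l) * y ^ l)"
    using f(2) by (simp add: lessThan_Suc_atMost[symmetric] eq_neg_iff_add_eq_0 add.commute)
  obtain d where d: "d \<noteq> 0" "\<forall>w\<in>(\<lambda>(k, i). y ^ k * x i) ` ({..<?m} \<times> {..<n}). of_int d * w \<in> lattice"
    using common_multiple_in_lattice[of "(\<lambda>(k, i). y ^ k * x i) ` ({..<?m} \<times> {..<n})" "\<lambda>d. d \<noteq> 0"]
      multiple_in_lattice by auto
  have "of_int d * (y ^ k * x i) \<in> lattice" if i: "i < n" for k i
  proof (induction k rule: less_induct)
    case (less k)
    show ?case
    proof (cases "k < ?m")
      case True
      thus ?thesis using d(2) i by force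
    next
      case False
      \<comment> \<open>All exponents \<open>k - ?m + l\<close> on the right are below
        \<open>k\<close>, so the induction hypothesis covers them.\<close>
      have "y ^ k = y ^ (k - ?m) * y ^ ?m" using False by (simp flip: power_add)
      also have "\<dots> = (\<Sum>l<?m. of_int (- poly.coeff f l) * y ^ (k - ?m + l))"
        unfolding ym by (simp add: sum_distrib_left power_add algebra_simps sum_negf)
      finally have "of_int d * (y ^ k * x i)
          = (\<Sum>l<?m. of_int (- poly.coeff f l) * (of_int d * (y ^ (k - ?m + l) * x i)))"
        by (simp add: sum_distrib_left sum_distrib_right algebra_simps sum_negf)
      also have "\<dots> \<in> lattice"
        using False by (intro lattice_sum lattice_smult less) auto
      finally show ?thesis .
    qed
  qed
  thus ?thesis using d(1) by blast
qed

text \<open>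
  The powers of an algebraic integer have multiplication matrices with a common denominator,
  so the powers of the rational number \<open>det Z / d^n\<close> have bounded denominators.
\<close>
lemma det_mult_matrix_algebraic_int:
  assumes "algebraic_int y" "mult_matrix d y Z" "d \<noteq> 0"
  shows "\<exists>N. det Z = d ^ n * N"
proof -
  have Z: "Z \<in> carrier_mat n n" using assms(2) by (simp add: mult_matrix_def)
  obtain e where e: "e \<noteq> 0" "\<forall>k. \<forall>i<n. of_int e * (y ^ k * x i) \<in> lattice"
    using algebraic_int_powers_lattice[OF assms(1)] by blast
  let ?t = "rat_of_int (det Z) / of_int (d ^ n)"
  have bounded: "of_int (e ^ n) * ?t ^ k \<in> \<int>" for k
  proof -
    obtain W where W: "mult_matrix e (y ^ k) W" using mult_matrix_exists e(2) by blast
    have "det (Z ^\<^sub>m k) = det Z ^ k"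
    proof (induction k)
      case (Suc k)
      thus ?case using Z det_mult[of "Z ^\<^sub>m k" n Z] by (simp add: mult.commute)
    qed (use Z in simp)
    hence "e ^ n * det Z ^ k = (d ^ k) ^ n * det W"
      using det_mult_matrix_unique[OF mult_matrix_power[OF assms(2)] W] by simp
    hence "e ^ n * det Z ^ k = (d ^ n) ^ k * det W" by (simp flip: power_mult add: mult.commute)
    hence "rat_of_int (e ^ n * det Z ^ k) = of_int ((d ^ n) ^ k * det W)" by (rule arg_cong)
    hence "of_int (e ^ n) * ?t ^ k = of_int (det W)" using assms(3)
      by (simp add: power_divide field_simps)
    thus ?thesis by simp
  qed
  have "?t \<in> \<int>" using e(1) by (intro Ints_if_powers_bounded_denominator[OF _ bounded]) simp
  then obtain N where "?t = of_int N" by (rule Ints_cases)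
  hence "rat_of_int (det Z) = of_int (d ^ n * N)" using assms(3) by (simp add: field_simps)
  hence "det Z = d ^ n * N" by (simp only: of_int_eq_iff)
  thus ?thesis by blast
qed

text \<open>The norms \<open>M\<close> of \<open>y\<close> and \<open>N\<close> of its inverse
  \<open>w\<close> are integers with product 1.\<close>

lemma det_mult_matrix_unit:
  assumes "algebraic_int y" "algebraic_int w" "y * w = 1" "mult_matrix d y Z" "d \<noteq> 0"
  shows "det Z = d ^ n \<or> det Z = - (d ^ n)"
proof -
  obtain e where e: "e \<noteq> 0" "\<forall>k. \<forall>i<n. of_int e * (w ^ k * x i) \<in> lattice"
    using algebraic_int_powers_lattice[OF assms(2)] by blast
  then obtain W where W: "mult_matrix e w W" 
    using mult_matrix_exists[of e w] by (metis power_one_right)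
  obtain M N where M: "det Z = d ^ n * M" and N: "det W = e ^ n * N"
    using det_mult_matrix_algebraic_int assms e(1) W by metis
  \<comment> \<open>As \<open>y * w = 1\<close>, the product \<open>Z * W\<close> can be compared
    with the identity matrix, which has denominator 1.\<close>
  have "det (Z * W) = (d * e) ^ n"
    using det_mult_matrix_unique[OF mult_matrix_mult[OF assms(4) W], of 1 "1\<^sub>m n"]
      mult_matrix_one assms(3) by simp
  moreover have "det (Z * W) = det Z * det W"
    using assms(4) W by (intro det_mult[where n = n]) (auto simp: mult_matrix_def)
  ultimately have "(d * e) ^ n * (M * N) = (d * e) ^ n * 1"
    by (simp add: M N power_mult_distrib algebra_simps)
  hence "M * N = 1" using e(1) assms(5) by (simp del: mult_1_right)
  hence "M = 1 \<or> M = -1" using zmult_eq_1_iff by blast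
  thus ?thesis by (auto simp: M)
qed

section \<open>Residues of integers and units modulo the prime ideal\<close>

text \<open>Modulo \<open>Q 1\<close> only the coordinate at \<open>x 0 = 1\<close> survives, so
  \<open>d * y\<close> is congruent to \<open>z 0\<close>; multiplying by an inverse
  \<open>v\<close> of \<open>d\<close> modulo \<open>p\<close> gives
  \<open>a = v * z 0\<close>.\<close>

lemma residue_is_integer:
  assumes y: "y \<in> Q 0"
  shows "\<exists>a. y - of_int a \<in> Q 1"
proof -
  obtain d where d: "\<not> int p dvd d" "of_int d * y \<in> lattice"
    using multiple_in_lattice_coprime[OF y] by blast
  obtain z :: "nat \<Rightarrow> int" where z: "of_int d * y = (\<Sum>j<n. of_int (z j) * x j)"
    using d(2) by (auto simp: lattice_def)
  have "coprime (int p) d" using p d(1) by (simp add: prime_imp_coprime)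
  then obtain u v where uv: "u * int p + v * d = 1"
    by (metis bezout_int coprime_imp_gcd_eq_1)
  have "of_int d * y - of_int (z 0) = (\<Sum>j\<in>{..<n} - {0}. of_int (z j) * x j)"
    unfolding z using n by (simp add: sum.remove[of "{..<n}" 0] x0)
  also have "\<dots> \<in> Q 1"
    using n x antimono[of 1] by (intro sum smult) (auto simp: subset_iff Suc_le_eq)
  finally have "of_int v * (of_int d * y - of_int (z 0)) \<in> Q 1" by (rule smult)
  moreover have "of_int (u * int p) * y \<in> Q 1"
    using n by (intro dvd_smult_in_Q[OF y]) auto
  ultimately have "of_int v * (of_int d * y - of_int (z 0)) + of_int (u * int p) * y \<in> Q 1"
    by (rule add)
  moreover have "of_int v * (of_int d * y - of_int (z 0)) + of_int (u * int p) * y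
      = of_int (u * int p + v * d) * y - of_int (v * z 0)"
    by (simp add: algebra_simps)
  ultimately have "y - of_int (v * z 0) \<in> Q 1" by (simp only: uv) simp
  thus ?thesis by blast
qed

text \<open>The determinant of \<open>Z\<close> is \<open>(d a)^n\<close> modulo \<open>p\<close> by
  triangularity, and \<open>d^n\<close> up to sign because \<open>y\<close> is a unit. Squaring
  removes the sign, and \<open>d\<close>, being prime to \<open>p\<close>, cancels.\<close>

lemma unit_residue_power:
  assumes "y \<in> Q 0" "algebraic_int y" "algebraic_int w" "y * w = 1" and a: "y - of_int a \<in> Q 1"
  shows "[a ^ (2 * n) = 1] (mod int p)"
proof -
  have "\<exists>d. \<not> int p dvd d \<and> (\<forall>u\<in>(\<lambda>i. y * x i) ` {..<n}. of_int d * u \<in> lattice)"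
  proof (rule common_multiple_in_lattice)
    show "\<exists>d. \<not> int p dvd d \<and> of_int d * u \<in> lattice" if "u \<in> (\<lambda>i. y * x i) ` {..<n}" for u
      using that mult[OF assms(1) x_in_Q0] by (auto intro: multiple_in_lattice_coprime)
    show "\<not> int p dvd 1" using prime_ge_2_nat[OF p] by simp
    show "\<not> int p dvd a * b" if "\<not> int p dvd a" "\<not> int p dvd b" for a b
      using that p by (simp add: prime_dvd_mult_iff)
  qed simp
  then obtain d where d: "\<not> int p dvd d" "\<forall>i<n. of_int d * (y * x i) \<in> lattice"
    by auto
  obtain Z where Z: "mult_matrix d y Z" using mult_matrix_exists d(2) by blast
  have Zc: "Z \<in> carrier_mat n n" using Z by (simp add: mult_matrix_def)
  \<comment> \<open>Multiplication by \<open>y - a\<close> raises the level of \<open>x i\<close> to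
    \<open>Suc i\<close>, so \<open>p\<close> divides its coordinates up to and including the
    diagonal one.\<close>
  have dvd: "int p dvd Z $$ (i, j) - (if i = j then d * a else 0)" if "i < n" "j \<le> i" for i j
  proof -
    let ?c = "\<lambda>j. Z $$ (i, j) - (if i = j then d * a else 0)"
    have "(\<Sum>j<n. of_int (?c j) * x j)
        = (\<Sum>j<n. of_int (Z $$ (i, j)) * x j) - (\<Sum>j<n. if i = j then of_int (d * a) * x j else 0)"
      unfolding sum_subtractf[symmetric] by (intro sum.cong) (auto simp: algebra_simps)
    also have "\<dots> = of_int d * ((y - of_int a) * x i)"
      using Z that by (simp add: mult_matrix_def algebra_simps)
    also have "\<dots> \<in> Q (Suc i)" using x[OF that(1)] by (intro smult mult1 a) auto
    finally show ?thesis using dvd_coeff[of ?c "Suc i" j] that by simp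
  qed
  have "[det Z = (d * a) ^ n] (mod int p)"
  proof (rule det_cong_upper_triangular[OF Zc])
    show "int p dvd Z $$ (i, j)" if "i < n" "j < i" for i j using dvd[of i j] that by simp
    show "[Z $$ (i, i) = d * a] (mod int p)" if "i < n" for i
      using dvd[of i i] that by (simp add: cong_iff_dvd_diff)
  qed
  hence "[det Z ^ 2 = ((d * a) ^ n) ^ 2] (mod int p)" by (rule cong_pow)
  moreover have "d \<noteq> 0" using d(1) by auto
  hence "det Z ^ 2 = (d ^ n) ^ 2"
    using det_mult_matrix_unit[OF assms(2-4) Z \<open>d \<noteq> 0\<close>] by (elim disjE) simp_all
  ultimately have "[(d ^ n) ^ 2 * 1 = (d ^ n) ^ 2 * a ^ (2 * n)] (mod int p)"
    by (simp add: power_mult_distrib power_mult[symmetric] mult.commute)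
  moreover have "coprime ((d ^ n) ^ 2) (int p)"
    using prime_imp_coprime[of "int p" d] d(1) p by (simp add: coprime_commute)
  ultimately show ?thesis by (simp add: cong_mult_lcancel cong_sym_eq del: mult_1_right)
qed

end

section \<open>Totally ramified primes\<close>

lemma ring_of_integers_simps [simp]:
  "carrier ring_of_integers = {x. algebraic_int x}"
  "x \<otimes>\<^bsub>ring_of_integers\<^esub> y = x * y" "\<one>\<^bsub>ring_of_integers\<^esub> = 1"
  "x \<oplus>\<^bsub>ring_of_integers\<^esub> y = x + y" "\<zero>\<^bsub>ring_of_integers\<^esub> = 0"
  by (simp_all add: ring_of_integers_def field_as_ring_def)

text \<open>The filtration consists of the powers of \<open>P\<close>; what takes work is that the
  degree is positive and that the powers decrease strictly up to it.\<close>

lemma totally_ramified_imp_ideal_filtration: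
  assumes "totally_ramified TYPE('a::field_char_0) p" and p: "prime p"
  shows "\<exists>Q :: nat \<Rightarrow> 'a set. ideal_filtration Q (field_degree TYPE('a)) p \<and> Q 0 = {x. algebraic_int x}"
proof -
  let ?R = "ring_of_integers :: 'a ring" and ?n = "field_degree TYPE('a)"
  obtain P where P: "primeideal P ?R"
    and ram: "PIdl\<^bsub>?R\<^esub> (of_nat p) = P [^]\<^bsub>ideals_set ?R\<^esub> ?n"
    using assms(1) unfolding totally_ramified_def by blast
  interpret P: primeideal P ?R by (rule P)
  interpret I: comm_monoid "ideals_set ?R" by (rule P.ideals_set_is_comm_monoid)
  define Q where "Q k = P [^]\<^bsub>ideals_set ?R\<^esub> k" for k :: nat
  have PI: "P \<in> carrier (ideals_set ?R)" using P.is_ideal by (simp add: ideals_set_def)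
  have Q0: "Q 0 = {x. algebraic_int x}" by (simp add: Q_def) (simp add: ideals_set_def)
  have QSuc: "Q (Suc k) = ideal_prod ?R (Q k) P" for k
    by (simp add: Q_def) (simp add: ideals_set_def)
  have ideal: "ideal (Q k) ?R" for k
    using I.nat_pow_closed[OF PI, of k] by (simp add: Q_def ideals_set_def)
  have Q1: "Q 1 = P" using I.nat_pow_eone[OF PI] by (simp add: Q_def)
  have Qn: "Q ?n = (*) (of_nat p) ` {x. algebraic_int x}"
    unfolding Q_def ram[symmetric] cgenideal_def by (auto simp: mult.commute)
  have mult: "x * y \<in> Q k" if "algebraic_int x" "y \<in> Q k" for x y k
    using ideal.I_l_closed[OF ideal that(2), of x] that(1) by simp
  have add: "x + y \<in> Q k" if "x \<in> Q k" "y \<in> Q k" for x y k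
    using additive_subgroup.a_closed[OF ideal.axioms(1)[OF ideal] that] by simp
  \<comment> \<open>For degree 0 the ideal generated by \<open>p\<close> would be
    \<open>P^0 = O\<close>, making \<open>1 / p\<close> an algebraic integer.\<close>
  have n: "?n > 0"
  proof (rule ccontr)
    assume "\<not> ?n > 0"
    hence "1 \<in> (*) (of_nat p) ` {x :: 'a. algebraic_int x}" using Qn Q0 by auto
    then obtain u :: 'a where u: "algebraic_int u" "of_nat p * u = 1" by force
    have "u = of_rat (1 / of_nat p)"
      using u(2) p by (simp add: of_rat_divide field_simps prime_gt_0_nat)
    hence "u \<in> \<rat>" by simp
    then obtain m where "u = of_int m"
      using rational_algebraic_int_is_int u(1) Ints_cases by metis
    hence "(of_int (int p * m) :: 'a) = of_int 1" using u(2) by simp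
    hence "int p * m = 1" by (simp only: of_int_eq_iff)
    hence "int p dvd 1" by (metis dvd_triv_left)
    thus False using prime_ge_2_nat[OF p] by simp
  qed
  have sub: "Q (Suc k) \<subseteq> Q k" for k
    using P.ideal_prod_inter[OF ideal P.is_ideal] by (auto simp: QSuc)
  \<comment> \<open>If \<open>P^(k + 1) = P^k\<close>, then \<open>p O = P^n = P^n P = p P\<close>, and so \<open>P\<close> contains 1.\<close>
  have "Q (Suc k) \<noteq> Q k" if k: "k < ?n" for k
  proof
    assume eq: "Q (Suc k) = Q k"
    \<comment> \<open>Once two consecutive powers agree, multiplying by \<open>P\<close> keeps the
      chain constant up to the exponent \<open>?n\<close>.\<close>
    have "Q (Suc m) = Q m" if "k \<le> m" for m
      using that by (induction m rule: dec_induct) (use eq in \<open>simp_all add: QSuc\<close>)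
    hence stable: "ideal_prod ?R (Q ?n) P = Q ?n" using k QSuc by simp
    have "z \<in> (*) (of_nat p) ` P" if "z \<in> ideal_prod ?R (Q ?n) P" for z
      using that
    proof (induction z rule: ideal_prod.induct)
      case (prod i j)
      then obtain u where u: "algebraic_int u" "i = of_nat p * u" using Qn by auto
      hence "u * j \<in> P" using P.I_l_closed[of j u] prod by simp
      thus ?case by (auto simp: u mult.assoc)
    next
      case (sum s t)
      then obtain u v where "u \<in> P" "v \<in> P" "s = of_nat p * u" "t = of_nat p * v" by auto
      thus ?case using additive_subgroup.a_closed[OF P.additive_subgroup_axioms, of u v]
        by (intro image_eqI[of _ _ "u + v"]) (simp_all add: distrib_left)
    qed
    moreover have "of_nat p \<in> Q ?n" unfolding Qn by (rule image_eqI[of _ _ 1]) auto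
    ultimately obtain u where "u \<in> P" "of_nat p = (of_nat p :: 'a) * u" using stable by blast
    hence "1 \<in> P" using p by (simp add: prime_gt_0_nat)
    hence "P = carrier ?R" using P.one_imp_carrier by simp
    thus False using P.I_notcarr by simp
  qed
  hence strict: "Q (Suc k) \<subset> Q k" if "k < ?n" for k using sub that by blast
  have "ideal_filtration Q ?n p"
  proof
    fix x y k assume "x \<in> Q k" "y \<in> Q k"
    thus "x - y \<in> Q k" using add[of x k "-1 * y"] mult[of "-1" y k] by (simp add: algebraic_int_minus)
  next
    fix x y k assume "x \<in> Q 1" and y: "y \<in> Q k"
    hence "x \<in> P" by (simp only: Q1)
    thus "x * y \<in> Q (Suc k)"
      using ideal_prod.prod[OF y, of x P ?R] by (simp add: QSuc mult.commute)
  qed (use Q0 Qn mult strict p n in auto)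
  thus ?thesis using Q0 by blast
qed

theorem theorem1:
  fixes p r :: nat
  assumes "number_field TYPE('a::field_char_0)"
    and "prime p" and "p \<ge> 3"
    and "totally_ramified TYPE('a) p"
    and "r = gcd (2 * class_number TYPE('a)) (p - 1)"
    and "gcd (field_degree TYPE('a)) ((p - 1) div 2) = 1"
    and "\<not> [resultant ([:0, 1:] ^ r - 1) (([:0, 1:] - 1) ^ r - 1) = (0::int)] (mod int p)"
  shows "\<not> (\<exists>l m :: 'a. l \<in> Units ring_of_integers \<and> m \<in> Units ring_of_integers \<and> l + m = 1)"
proof
  let ?n = "field_degree TYPE('a)"
  assume "\<exists>l m :: 'a. l \<in> Units ring_of_integers \<and> m \<in> Units ring_of_integers \<and> l + m = 1"
  then obtain l m :: 'a where lm: "l \<in> Units ring_of_integers" "m \<in> Units ring_of_integers" "l + m = 1"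
    by blast
  obtain Q :: "nat \<Rightarrow> 'a set" where Q: "ideal_filtration Q ?n p" and Q0: "Q 0 = {x. algebraic_int x}"
    using totally_ramified_imp_ideal_filtration[OF assms(4,2)] by blast
  obtain x where "adapted_basis Q ?n p x" using ideal_filtration.adapted_basis_exists[OF Q] by blast
  then interpret adapted_rat_basis Q ?n p x
    using assms(1) by (simp add: adapted_rat_basis_def adapted_rat_basis_axioms_def)
  \<comment> \<open>Every unit is congruent to 1 or -1 modulo \<open>P\<close>.\<close>
  have residue: "\<exists>a. y - of_int a \<in> Q 1 \<and> (int p dvd a - 1 \<or> int p dvd a + 1)"
    if y: "y \<in> Units ring_of_integers" for y :: 'a
  proof -
    obtain w where w: "algebraic_int y" "algebraic_int w" "y * w = 1"
      using y by (auto simp: Units_def)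
    obtain a where a: "y - of_int a \<in> Q 1" using residue_is_integer w(1) Q0 by blast
    have "[a ^ 2 = 1] (mod int p)"
      using unit_residue_power[OF _ w a] w(1) Q0 n
      by (intro cong_square_eq_1[OF assms(2,3) _ assms(6)]) auto
    hence "int p dvd (a - 1) * (a + 1)"
      by (simp add: cong_iff_dvd_diff power2_eq_square algebra_simps)
    thus ?thesis using a assms(2) by (auto simp: prime_dvd_mult_iff)
  qed
  obtain a b where a: "l - of_int a \<in> Q 1" "int p dvd a - 1 \<or> int p dvd a + 1"
    and b: "m - of_int b \<in> Q 1" "int p dvd b - 1 \<or> int p dvd b + 1"
    using residue lm(1,2) by meson
  have eq: "(l - of_int a) + (m - of_int b) = of_int (1 - (a + b))"
    using lm(3) by (simp add: algebra_simps)
  have "of_int (1 - (a + b)) \<in> Q 1" using add[OF a(1) b(1)] unfolding eq .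
  hence ab: "int p dvd 1 - (a + b)" by (simp only: of_int_in_Q1_iff)
  \<comment> \<open>If the residues are not both -1, their sum is 2 or 0, which differs from 1 by 1
    or -1. The remaining sum -2 differs from 1 by 3.\<close>
  have "\<not> int p dvd 1" using prime_ge_2_nat[OF assms(2)] by simp
  moreover have "int p dvd 1" if "int p dvd a - 1" "int p dvd b - 1"
    using dvd_add[OF ab dvd_add[OF that]] by simp
  moreover have "int p dvd 1" if "int p dvd a - 1" "int p dvd b + 1"
    using dvd_add[OF ab dvd_add[OF that]] by simp
  moreover have "int p dvd 1" if "int p dvd a + 1" "int p dvd b - 1"
    using dvd_add[OF ab dvd_add[OF that]] by simp
  ultimately have "int p dvd a + 1" "int p dvd b + 1" using a(2) b(2) by blast+
  hence "int p dvd 3" using dvd_add[OF ab dvd_add[of "int p" "a + 1" "b + 1"]] by simp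
  hence "int p \<le> 3" by (rule zdvd_imp_le) simp
  hence "p = 3" using assms(3) by simp
  \<comment> \<open>For \<open>p = 3\<close> the gcd of the even number \<open>2 * h\<close> with
    \<open>p - 1 = 2\<close> is 2, whatever the class number \<open>h\<close>.\<close>
  hence "r = 2" using assms(5) by (simp add: gcd.commute[of _ 2])
  thus False using assms(7) three_dvd_resultant \<open>p = 3\<close> by simp
qed

end
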